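(* Let $(X,\leq)$ be a partially ordered set endowed with a metric $d$ such that $(X,d)$ is complete, let $\varepsilon>0$ and $\lambda\in(0,1)$, and let $F:X\times X\to X$ be a mapping. Assume that: 1. $X$ is $\varepsilon$-chainable with respect to the partial order $\leq$; 2. $F$ is continuous; 3. $F$ has the mixed monotone property; 4. $F$ is $(\varepsilon,\lambda)$ uniformly locally contractive; 5. there exist $x_0,y_0\in X$ such that $x_0\leq F(x_0,y_0)$ and $y_0\geq F(y_0,x_0)$; 6. for all $(x,y),(x^*,y^* )\in X\times X$ there exists $(z_1,z_2)\in X\times X$ that is comparable, in the partial order on $X\times X$, to both $(x,y)$ and $(x^*,y^* )$. Then $F$ has a unique coupled fixed point, i.e. there is exactly one $(x,y)\in X\times X$ with $F(x,y)=x$ and $F(y,x)=y$.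
   Context: Let $(X,\leq)$ be a partially ordered set endowed with a metric $d$ and let $F:X\times X\to X$. $X\times X$ carries the partial order $(u,v)\leq(x,y)\Leftrightarrow x\geq u$ and $y\leq v$, and the metric $\eta((x,y),(u,v))=d(x,u)+d(y,v)$; continuity of $F$ is with respect to $\eta$ and $d$. Two elements of a partially ordered set are comparable if one of them is $\leq$ the other. $X$ is $\varepsilon$-chainable with respect to $\leq$ ($\varepsilon>0$) if for any $a,b\in X$ with $a\leq b$ there exist an integer $n\geq 1$ and points $a=\alpha_0\leq\alpha_1\leq\cdots\leq\alpha_{n-1}\leq\alpha_n=b$ of $X$ such that $d(\alpha_{i-1},\alpha_i)<\varepsilon$ for all $i=1,\dots,n$. $F$ has the mixed monotone property if for all $x,y\in X$: $x_1\leq x_2$ in $X$ implies $F(x_1,y)\leq F(x_2,y)$, and $y_1\leq y_2$ in $X$ implies $F(x,y_1)\geq F(x,y_2)$. $F$ is $(\varepsilon,\lambda)$ uniformly locally contractive ($\varepsilon>0$, $\lambda\in(0,1)$) if for all $x,y,u,v\in X$ with $x\geq u$, $y\leq v$ and $(x,y)\neq(u,v)$: $\frac{d(x,u)+d(y,v)}{2}<\varepsilon$ implies $d(F(x,y),F(u,v))<\frac{\lambda}{2}[d(x,u)+d(y,v)]$. *)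

theory Defs
  imports "HOL-Analysis.Analysis"
begin

text \<open>
  The partially ordered complete metric space \<open>X\<close> is the universe of a type of sort
  \<open>{order, complete_space}\<close>. The two classes are independent: no compatibility between
  the order and the metric is assumed.

  The product order and the product metric below differ from the library's: the order is
  reversed in the second component (unlike \<open>Product_Order\<close>), and the metric is the
  sum metric (unlike the Euclidean \<open>dist\<close> on pairs).
\<close>

definition pair_le :: "'a::order \<times> 'a \<Rightarrow> 'a \<times> 'a \<Rightarrow> bool" where
  "pair_le = (\<lambda>(u, v) (x, y). x \<ge> u \<and> y \<le> v)"

definition eta :: "'a::metric_space \<times> 'a \<Rightarrow> 'a \<times> 'a \<Rightarrow> real" where
  "eta = (\<lambda>(x, y) (u, v). dist x u + dist y v)"

definition comparable :: "('b \<Rightarrow> 'b \<Rightarrow> bool) \<Rightarrow> 'b \<Rightarrow> 'b \<Rightarrow> bool" where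
  "comparable le p q \<longleftrightarrow> le p q \<or> le q p"

definition chainable_on :: "'a::{order,metric_space} set \<Rightarrow> real \<Rightarrow> bool" where
  "chainable_on X \<epsilon> \<longleftrightarrow>
     (\<forall>a\<in>X. \<forall>b\<in>X. a \<le> b \<longrightarrow>
        (\<exists>n\<ge>1. \<exists>\<alpha>::nat \<Rightarrow> 'a.
           (\<forall>i\<le>n. \<alpha> i \<in> X) \<and> \<alpha> 0 = a \<and> \<alpha> n = b \<and>
           (\<forall>i\<in>{1..n}. \<alpha> (i - 1) \<le> \<alpha> i \<and> dist (\<alpha> (i - 1)) (\<alpha> i) < \<epsilon>)))"

definition mixed_monotone :: "('a::order \<times> 'a \<Rightarrow> 'a) \<Rightarrow> bool" where
  "mixed_monotone F \<longleftrightarrow>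
     (\<forall>x y. (\<forall>x\<^sub>1 x\<^sub>2. x\<^sub>1 \<le> x\<^sub>2 \<longrightarrow> F (x\<^sub>1, y) \<le> F (x\<^sub>2, y)) \<and>
            (\<forall>y\<^sub>1 y\<^sub>2. y\<^sub>1 \<le> y\<^sub>2 \<longrightarrow> F (x, y\<^sub>1) \<ge> F (x, y\<^sub>2)))"

definition uniformly_locally_contractive ::
  "real \<Rightarrow> real \<Rightarrow> ('a::{order,metric_space} \<times> 'a \<Rightarrow> 'a) \<Rightarrow> bool" where
  "uniformly_locally_contractive \<epsilon> lam F \<longleftrightarrow>
     (\<forall>x y u v. x \<ge> u \<longrightarrow> y \<le> v \<longrightarrow> (x, y) \<noteq> (u, v) \<longrightarrow>
        (dist x u + dist y v) / 2 < \<epsilon> \<longrightarrow>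
        dist (F (x, y)) (F (u, v)) < lam / 2 * (dist x u + dist y v))"

definition coupled_fixed_point :: "('a \<times> 'a \<Rightarrow> 'a) \<Rightarrow> 'a \<times> 'a \<Rightarrow> bool" where
  "coupled_fixed_point F = (\<lambda>(x, y). F (x, y) = x \<and> F (y, x) = y)"

lemma ordering_pair_le: "ordering pair_le (\<lambda>p q. pair_le p q \<and> p \<noteq> q)"
  by standard (auto simp: pair_le_def)

text \<open>\<open>Metric_space.mtopology\<close> is only meaningful for an actual metric.\<close>

lemma Metric_space_eta: "Metric_space UNIV (eta :: 'a::metric_space \<times> 'a \<Rightarrow> _)"
proof
  fix p q r :: "'a \<times> 'a"
  show "0 \<le> eta p q" by (simp add: eta_def split: prod.split)
  show "eta p q = eta q p" by (simp add: eta_def dist_commute split: prod.split)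
  show "eta p q = 0 \<longleftrightarrow> p = q"
    by (simp add: eta_def add_nonneg_eq_0_iff split: prod.split)
  show "eta p r \<le> eta p q + eta q r"
    using dist_triangle[of "fst p" "fst r" "fst q"] dist_triangle[of "snd p" "snd r" "snd q"]
    by (simp add: eta_def case_prod_beta)
qed

end

theory Submission
  imports Defs
begin

text \<open>
  A coupled fixed point of \<open>F\<close> is a fixed point of \<open>T (x, y) = (F (x, y), F (y, x))\<close> on
  \<open>X \<times> X\<close>. Mixed monotonicity says that \<open>T\<close> is monotone for \<open>pair_le\<close>, and the local contraction
  hypothesis, applied once to each component, says that \<open>T\<close> shrinks the \<open>eta\<close>-distance of two
  comparable pairs by the factor \<open>lam\<close> as soon as that distance is below \<open>2 * \<epsilon>\<close>. Images of such
  pairs are again comparable and close, so their orbits approach each other geometrically: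
  \<open>eta (T\<^sup>n p) (T\<^sup>n q) \<le> C * lam ^ n\<close>.

  The restriction to close pairs is removed by observing that ``the orbits of \<open>p\<close> and \<open>q\<close> approach
  each other geometrically'' (\<open>geometrically_close\<close>) is an equivalence relation, the constant \<open>C\<close>
  being allowed to depend on the pair. Two comparable pairs are joined by an \<open>\<epsilon>\<close>-chain that moves
  the first coordinate and then the second, hence they are equivalent
  (\<open>comparable_geometrically_close\<close>). By the last hypothesis all pairs are then equivalent.

  Both halves of the theorem are read off from this. The starting pair is comparable, hence
  related, to its image under \<open>T\<close>, so the distances of consecutive points of its orbit are bounded by a geometric
  sequence; the orbit converges, and by continuity its limit is fixed. Two fixed points are
  related, but their orbits are constant, so their distance is at most \<open>C * lam ^ n\<close> for all \<open>n\<close>,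
  that is, zero.
\<close>

section \<open>Orbits that approach each other geometrically\<close>

definition coupled_map :: "('a \<times> 'a \<Rightarrow> 'a) \<Rightarrow> 'a \<times> 'a \<Rightarrow> 'a \<times> 'a" where
  "coupled_map F p = (F p, F (prod.swap p))"

lemma coupled_fixed_point_iff: "coupled_fixed_point F p \<longleftrightarrow> coupled_map F p = p"
  by (cases p) (simp add: coupled_fixed_point_def coupled_map_def)

text \<open>
  The constant is existential and not a multiple of \<open>eta p q\<close>: along a chain it becomes the sum of the
  constants of the links, which \<open>eta p q\<close> does not control, and only the rate \<open>lam\<close> is uniform.
\<close>

definition geometrically_close ::
  "real \<Rightarrow> ('a::metric_space \<times> 'a \<Rightarrow> 'a \<times> 'a) \<Rightarrow> 'a \<times> 'a \<Rightarrow> 'a \<times> 'a \<Rightarrow> bool" where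
  "geometrically_close lam T p q \<longleftrightarrow> (\<exists>C. \<forall>n. eta ((T ^^ n) p) ((T ^^ n) q) \<le> C * lam ^ n)"

interpretation eta: Metric_space UNIV "eta :: 'a::metric_space \<times> 'a \<Rightarrow> _"
  by (rule Metric_space_eta)

lemma geometrically_close_refl: "geometrically_close lam T p p"
  unfolding geometrically_close_def by (rule exI[of _ 0]) simp

lemma geometrically_close_sym:
  "geometrically_close lam T p q \<Longrightarrow> geometrically_close lam T q p"
  unfolding geometrically_close_def by (simp add: eta.commute)

lemma geometrically_close_trans:
  assumes "geometrically_close lam T p q" "geometrically_close lam T q r"
  shows "geometrically_close lam T p r"
proof -
  from assms obtain C D where
    C: "\<And>n. eta ((T ^^ n) p) ((T ^^ n) q) \<le> C * lam ^ n" and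
    D: "\<And>n. eta ((T ^^ n) q) ((T ^^ n) r) \<le> D * lam ^ n"
    unfolding geometrically_close_def by blast
  have "eta ((T ^^ n) p) ((T ^^ n) r) \<le> (C + D) * lam ^ n" for n
    using eta.triangle[of "(T ^^ n) p" "(T ^^ n) q" "(T ^^ n) r"] C[of n] D[of n]
    by (simp add: distrib_right)
  then show ?thesis
    unfolding geometrically_close_def by blast
qed

text \<open>
  Chainability enters the proof only through this principle: a reflexive and transitive relation
  that holds along short upward steps holds along all upward steps.
\<close>

lemma chainable_extend:
  fixes a b :: "'a::{order,metric_space}"
  assumes chain: "chainable_on (UNIV :: 'a set) \<epsilon>" and "a \<le> b"
    and refl: "\<And>x. R x x"
    and trans: "\<And>x y z. R x y \<Longrightarrow> R y z \<Longrightarrow> R x z"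
    and short: "\<And>x y. x \<le> y \<Longrightarrow> dist x y < \<epsilon> \<Longrightarrow> R x y"
  shows "R a b"
proof -
  obtain n :: nat and \<alpha> where ends: "\<alpha> 0 = a" "\<alpha> n = b"
    and step: "\<And>i. i \<in> {1..n} \<Longrightarrow> \<alpha> (i - 1) \<le> \<alpha> i \<and> dist (\<alpha> (i - 1)) (\<alpha> i) < \<epsilon>"
    using chain \<open>a \<le> b\<close> unfolding chainable_on_def by (metis UNIV_I)
  have "R (\<alpha> 0) (\<alpha> k)" if "k \<le> n" for k
    using that
  proof (induction k)
    case 0
    show ?case by (rule refl)
  next
    case (Suc k)
    have "R (\<alpha> k) (\<alpha> (Suc k))"
      using step[of "Suc k"] Suc.prems by (intro short) auto
    then show ?case
      using Suc trans by (meson Suc_leD)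
  qed
  then show ?thesis
    using ends by blast
qed

section \<open>Comparable pairs\<close>

lemma coupled_map_mono:
  assumes mono: "mixed_monotone F" and "pair_le p q"
  shows "pair_le (coupled_map F p) (coupled_map F q)"
proof -
  obtain u v x y where pq: "p = (u, v)" "q = (x, y)" and le: "u \<le> x" "y \<le> v"
    using \<open>pair_le p q\<close> by (cases p, cases q) (auto simp: pair_le_def)
  have "F (u, v) \<le> F (x, v)" "F (x, v) \<le> F (x, y)"
    "F (y, x) \<le> F (v, x)" "F (v, x) \<le> F (v, u)"
    using mono le unfolding mixed_monotone_def by blast+
  then show ?thesis
    by (auto simp: pq coupled_map_def pair_le_def intro: order_trans)
qed

text \<open>
  For the second component the hypothesis is used at \<open>(v, u)\<close> and \<open>(y, x)\<close>: swapping coordinates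
  reverses \<open>pair_le\<close> and preserves \<open>eta\<close>. The factor \<open>1 / 2\<close> of the hypothesis is absorbed by
  adding the two components.
\<close>

lemma coupled_map_contracts:
  assumes contr: "uniformly_locally_contractive \<epsilon> lam F"
    and le: "pair_le p q" and close: "eta p q < 2 * \<epsilon>"
  shows "eta (coupled_map F p) (coupled_map F q) \<le> lam * eta p q"
proof (cases "p = q")
  case True
  then show ?thesis by simp
next
  case False
  obtain u v x y where pq: "p = (u, v)" "q = (x, y)"
    by (cases p, cases q)
  have le': "u \<le> x" "y \<le> v"
    using le by (auto simp: pq pair_le_def)
  have eta: "dist x u + dist y v = eta p q" "dist v y + dist u x = eta p q"
    by (simp_all add: pq eta_def dist_commute)
  have ne: "(x, y) \<noteq> (u, v)" "(v, u) \<noteq> (y, x)"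
    using False by (auto simp: pq)
  have "dist (F (x, y)) (F (u, v)) < lam / 2 * eta p q"
    using contr[unfolded uniformly_locally_contractive_def, rule_format, OF le' ne(1)] close
    unfolding eta by simp
  moreover have "dist (F (v, u)) (F (y, x)) < lam / 2 * eta p q"
    using contr[unfolded uniformly_locally_contractive_def, rule_format, OF le'(2,1) ne(2)] close
    unfolding eta by simp
  ultimately show ?thesis
    by (simp add: pq coupled_map_def eta_def dist_commute)
qed

text \<open>
  Since the image of a close comparable pair is again comparable, by monotonicity, and no farther
  apart, the contraction estimate can be applied at every iterate.
\<close>

lemma small_step_geometrically_close:
  assumes lam: "0 < lam" "lam < 1" and mono: "mixed_monotone F"
    and contr: "uniformly_locally_contractive \<epsilon> lam F"
    and le: "pair_le p q" and close: "eta p q < 2 * \<epsilon>"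
  shows "geometrically_close lam (coupled_map F) p q"
proof -
  let ?T = "coupled_map F"
  have "pair_le ((?T ^^ n) p) ((?T ^^ n) q) \<and> eta ((?T ^^ n) p) ((?T ^^ n) q) \<le> eta p q * lam ^ n"
    for n
  proof (induction n)
    case 0
    then show ?case using le by simp
  next
    case (Suc n)
    have "eta p q * lam ^ n \<le> eta p q * 1"
      using lam by (intro mult_left_mono power_le_one) auto
    \<comment> \<open>so the iterates have not left the range in which the contraction hypothesis applies\<close>
    with Suc close have "eta ((?T ^^ n) p) ((?T ^^ n) q) < 2 * \<epsilon>"
      by simp
    with Suc contr have "eta (?T ((?T ^^ n) p)) (?T ((?T ^^ n) q))
        \<le> lam * eta ((?T ^^ n) p) ((?T ^^ n) q)"
      by (blast intro: coupled_map_contracts)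
    also have "\<dots> \<le> lam * (eta p q * lam ^ n)"
      using Suc lam by (intro mult_left_mono) auto
    finally show ?case
      using Suc coupled_map_mono[OF mono] by (simp add: mult_ac)
  qed
  then show ?thesis
    unfolding geometrically_close_def by blast
qed

text \<open>
  An \<open>\<epsilon>\<close>-chain in one coordinate, with the other coordinate held fixed, has
  comparable consecutive pairs at \<open>eta\<close>-distance below \<open>\<epsilon>\<close>. Since \<open>pair_le\<close> reverses the order of the second
  coordinate, the second chain runs downwards, from \<open>(x, v)\<close> to \<open>(x, y)\<close>; it is traversed backwards
  and the symmetry of the relation is used.
\<close>

lemma pair_le_geometrically_close:
  fixes F :: "'a::{order,metric_space} \<times> 'a \<Rightarrow> 'a"
  assumes eps: "\<epsilon> > 0" and lam: "0 < lam" "lam < 1"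
    and chain: "chainable_on (UNIV :: 'a set) \<epsilon>" and mono: "mixed_monotone F"
    and contr: "uniformly_locally_contractive \<epsilon> lam F"
    and le: "pair_le p q"
  shows "geometrically_close lam (coupled_map F) p q"
proof -
  obtain u v x y where pq: "p = (u, v)" "q = (x, y)" and le': "u \<le> x" "y \<le> v"
    using le by (cases p, cases q) (auto simp: pair_le_def)
  let ?R = "geometrically_close lam (coupled_map F)"
  note small = small_step_geometrically_close[OF lam mono contr]
  have "?R (u, v) (x, v)"
  proof (rule chainable_extend[OF chain le'(1), where R = "\<lambda>a b. ?R (a, v) (b, v)"])
    fix a b :: 'a assume "a \<le> b" "dist a b < \<epsilon>"
    then show "?R (a, v) (b, v)"
      using eps by (intro small) (simp_all add: pair_le_def eta_def)
  qed (blast intro: geometrically_close_refl geometrically_close_trans)+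
  moreover have "?R (x, y) (x, v)"
  proof (rule chainable_extend[OF chain le'(2), where R = "\<lambda>a b. ?R (x, a) (x, b)"])
    fix a b :: 'a assume "a \<le> b" "dist a b < \<epsilon>"
    then have "?R (x, b) (x, a)"
      using eps by (intro small) (simp_all add: pair_le_def eta_def dist_commute)
    then show "?R (x, a) (x, b)"
      by (rule geometrically_close_sym)
  qed (blast intro: geometrically_close_refl geometrically_close_trans)+
  ultimately show ?thesis
    unfolding pq by (blast intro: geometrically_close_sym geometrically_close_trans)
qed

lemma comparable_geometrically_close:
  fixes F :: "'a::{order,metric_space} \<times> 'a \<Rightarrow> 'a"
  assumes "\<epsilon> > 0" "0 < lam" "lam < 1" "chainable_on (UNIV :: 'a set) \<epsilon>" "mixed_monotone F"
    "uniformly_locally_contractive \<epsilon> lam F" "comparable pair_le p q"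
  shows "geometrically_close lam (coupled_map F) p q"
  using assms(7) pair_le_geometrically_close[OF assms(1-6)] geometrically_close_sym
  unfolding comparable_def by blast

section \<open>Existence and uniqueness of the fixed point\<close>

lemma convergent_if_geometric_steps:
  fixes s :: "nat \<Rightarrow> 'a::complete_space"
  assumes lam: "0 < lam" "lam < 1" and step: "\<And>n. dist (s n) (s (Suc n)) \<le> C * lam ^ n"
  shows "convergent s"
proof -
  \<comment> \<open>\<open>B n\<close> is the sum of the bounds \<open>C * lam ^ i\<close> over all \<open>i \<ge> n\<close>\<close>
  define D where "D = C / (1 - lam)"
  define B where "B n = D * lam ^ n" for n
  have C_eq: "C = D * (1 - lam)"
    using lam by (simp add: D_def)
  have tail: "dist (s n) (s (n + k)) \<le> B n - B (n + k)" for n k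
  proof (induction k)
    case 0
    show ?case by simp
  next
    case (Suc k)
    have "C * lam ^ (n + k) = B (n + k) - B (n + Suc k)"
      by (simp add: B_def C_eq algebra_simps)
    then show ?case
      using Suc step[of "n + k"] dist_triangle[of "s n" "s (n + Suc k)" "s (n + k)"] by simp
  qed
  have "0 \<le> C"
    using order_trans[OF zero_le_dist step[of 0]] by simp
  then have nonneg: "0 \<le> B n" for n
    using lam by (simp add: B_def D_def)
  have "B \<longlonglongrightarrow> 0"
    unfolding B_def using lam by (intro tendsto_mult_right_zero LIMSEQ_power_zero) simp
  have "Cauchy s"
  proof (rule CauchyI')
    fix e :: real assume "0 < e"
    then obtain M where M: "\<And>m. m \<ge> M \<Longrightarrow> B m < e"
      using order_tendstoD(2)[OF \<open>B \<longlonglongrightarrow> 0\<close>] unfolding eventually_sequentially by blast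
    have "dist (s m) (s n) < e" if "m \<ge> M" "m < n" for m n
      using tail[of m "n - m"] nonneg[of n] M[of m] that by simp
    then show "\<exists>M. \<forall>m\<ge>M. \<forall>n>m. dist (s m) (s n) < e"
      by blast
  qed
  then show ?thesis
    by (rule Cauchy_convergent)
qed

lemma continuous_eta_sequentially:
  fixes F :: "'a::metric_space \<times> 'a \<Rightarrow> 'a"
  assumes cont: "continuous_map (Metric_space.mtopology UNIV eta) (Metric_space.mtopology UNIV dist) F"
    and x: "x \<longlonglongrightarrow> a" and y: "y \<longlonglongrightarrow> b"
  shows "(\<lambda>n. F (x n, y n)) \<longlonglongrightarrow> F (a, b)"
proof -
  have "(\<lambda>n. dist (x n) a + dist (y n) b) \<longlonglongrightarrow> 0 + 0"
    using x y by (intro tendsto_add) (simp_all flip: tendsto_dist_iff)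
  then have "(\<lambda>n. eta (x n, y n) (a, b)) \<longlonglongrightarrow> 0"
    by (simp add: eta_def)
  then have "limitin eta.mtopology (\<lambda>n. (x n, y n)) (a, b) sequentially"
    by (auto simp: eta.limitin_metric intro: order_tendstoD)
  from continuous_map_limit[OF cont this] show ?thesis
    by (simp add: o_def)
qed

text \<open>
  If \<open>p\<close> is related to its image, the orbit of \<open>p\<close> is compared with its own shift, which bounds the
  steps of the orbit. Completeness is applied to each coordinate separately; the two limits
  \<open>x\<close> and \<open>y\<close> then satisfy both fixed point equations by continuity of \<open>F\<close>
  at \<open>(x, y)\<close> and at \<open>(y, x)\<close>.
\<close>

lemma geometrically_close_orbit_limit_fixed:
  fixes F :: "'a::complete_space \<times> 'a \<Rightarrow> 'a"
  assumes lam: "0 < lam" "lam < 1"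
    and cont: "continuous_map (Metric_space.mtopology UNIV eta) (Metric_space.mtopology UNIV dist) F"
    and close: "geometrically_close lam (coupled_map F) p (coupled_map F p)"
  shows "\<exists>q. coupled_map F q = q"
proof -
  define s where "s n = (coupled_map F ^^ n) p" for n
  have Suc: "s (Suc n) = coupled_map F (s n)" for n
    by (simp add: s_def)
  obtain C where C: "\<And>n. eta (s n) (s (Suc n)) \<le> C * lam ^ n"
    using close unfolding geometrically_close_def s_def by (auto simp: funpow_swap1)
  have le_eta: "dist (fst r) (fst r') \<le> eta r r'" "dist (snd r) (snd r') \<le> eta r r'"
    for r r' :: "'a \<times> 'a"
    by (simp_all add: eta_def case_prod_beta)
  obtain x where x: "(\<lambda>n. fst (s n)) \<longlonglongrightarrow> x"
    using convergent_if_geometric_steps[OF lam, of "\<lambda>n. fst (s n)"] order_trans[OF le_eta(1) C]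
    by (auto simp: convergent_def)
  obtain y where y: "(\<lambda>n. snd (s n)) \<longlonglongrightarrow> y"
    using convergent_if_geometric_steps[OF lam, of "\<lambda>n. snd (s n)"] order_trans[OF le_eta(2) C]
    by (auto simp: convergent_def)
  have "(\<lambda>n. fst (s (Suc n))) \<longlonglongrightarrow> F (x, y)" "(\<lambda>n. snd (s (Suc n))) \<longlonglongrightarrow> F (y, x)"
    using continuous_eta_sequentially[OF cont x y] continuous_eta_sequentially[OF cont y x]
    by (simp_all add: Suc coupled_map_def prod.swap_def)
  then have "F (x, y) = x" "F (y, x) = y"
    using LIMSEQ_unique LIMSEQ_Suc[OF x] LIMSEQ_Suc[OF y] by blast+
  then show ?thesis
    by (intro exI[of _ "(x, y)"]) (simp add: coupled_map_def)
qed

lemma geometrically_close_fixed_points_eq: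
  assumes lam: "0 < lam" "lam < 1" and close: "geometrically_close lam T p q"
    and fixed: "T p = p" "T q = q"
  shows "p = q"
proof -
  have "(T ^^ n) p = p" "(T ^^ n) q = q" for n
    by (induction n) (simp_all add: fixed)
  with close obtain C where C: "\<And>n. eta p q \<le> C * lam ^ n"
    unfolding geometrically_close_def by auto
  have "(\<lambda>n. C * lam ^ n) \<longlonglongrightarrow> 0"
    using lam by (intro tendsto_mult_right_zero LIMSEQ_power_zero) simp
  then have "eta p q \<le> 0"
    by (rule LIMSEQ_le_const) (use C in blast)
  then show ?thesis
    using eta.nonneg[of p q] eta.zero[of p q] by simp
qed

theorem theorem2p3:
  fixes F :: "'a::{order,complete_space} \<times> 'a \<Rightarrow> 'a"
    and \<epsilon> lam :: real
  assumes "\<epsilon> > 0"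
    and "lam \<in> {0<..<1}"
    and "chainable_on (UNIV :: 'a set) \<epsilon>"
    and "continuous_map (Metric_space.mtopology UNIV eta) (Metric_space.mtopology UNIV dist) F"
    and "mixed_monotone F"
    and "uniformly_locally_contractive \<epsilon> lam F"
    and "\<exists>x\<^sub>0 y\<^sub>0. x\<^sub>0 \<le> F (x\<^sub>0, y\<^sub>0) \<and> y\<^sub>0 \<ge> F (y\<^sub>0, x\<^sub>0)"
    and "\<forall>p q :: 'a \<times> 'a. \<exists>z. comparable pair_le z p \<and> comparable pair_le z q"
  shows "\<exists>!p. coupled_fixed_point F p"
proof -
  let ?T = "coupled_map F"
  have lam: "0 < lam" "lam < 1"
    using assms(2) by auto
  note close = comparable_geometrically_close[OF assms(1) lam assms(3,5,6)]
  obtain x\<^sub>0 y\<^sub>0 where "x\<^sub>0 \<le> F (x\<^sub>0, y\<^sub>0)" "F (y\<^sub>0, x\<^sub>0) \<le> y\<^sub>0"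
    using assms(7) by blast
  then have "comparable pair_le (x\<^sub>0, y\<^sub>0) (?T (x\<^sub>0, y\<^sub>0))"
    by (simp add: comparable_def pair_le_def coupled_map_def)
  then obtain q where "?T q = q"
    using geometrically_close_orbit_limit_fixed[OF lam assms(4) close] by blast
  moreover have "p = q" if "?T p = p" "?T q = q" for p q
  proof -
    obtain z where "comparable pair_le z p" "comparable pair_le z q"
      using assms(8) by blast
    then have "geometrically_close lam ?T p q"
      by (blast intro: close geometrically_close_sym geometrically_close_trans)
    then show ?thesis
      using geometrically_close_fixed_points_eq[OF lam] that by blast
  qed
  ultimately show ?thesis
    unfolding coupled_fixed_point_iff by blast
qed

end
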